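(* For all odd $m\ge1$, $G(\mathcal D_m,\mathcal C_2,\psi_1)$ is conjugate to $G(\mathcal D_{2m},\mathbf 1,\psi_{2m-1})$ in $\mathrm U_2(\mathbb H)$.
   Context: $\mathbb H$ is the real quaternion algebra with units $i,j,k$, and $\mathbb S^3$ is the group of quaternions of norm $1$. $\mathrm U_2(\mathbb H)$ is the group of $2\times2$ quaternionic matrices $A$ with $A\overline A^{\top}=I$. For a finite subgroup $K$ of $\mathbb S^3$, $H\trianglelefteq K$ and $\varphi\in\mathrm{Aut}(K/H)$ with $\varphi^2=1$, $G(K,H,\varphi)\subset \mathrm U_2(\mathbb H)$ is the group of order $2|K||H|$ consisting of all matrices $\mathrm{diag}(\xi,\eta)$ with $\xi,\eta\in K$, $\varphi(H\xi)=H\eta$, together with their products with $\begin{pmatrix}0&1\\1&0\end{pmatrix}$. Here $\mathbf 1$ denotes the trivial group. Let $\zeta_q=\cos(2\pi/q)+i\sin(2\pi/q)$, $\mathcal C_2=\{\pm1\}$, $\mathcal D_q=\langle\zeta_{2q},j\rangle$ (order $4q$). For $H=\mathbf 1$ or $H=\mathcal C_2$, $\psi_r$ denotes the automorphism of $\mathcal D_q/H$ with $\psi_r(Hx)=Hx^r$ and $\psi_r(Hy)=Hy^{-1}$, where $x=\zeta_{2q}$ and $y=j$. *)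

theory Defs
  imports
    "HOL-Analysis.Analysis"
    "HOL-Algebra.Coset"
    "HOL-Algebra.Bij"
    "HOL-Algebra.Generated_Groups"
begin

section \<open>The real quaternion algebra\<close>

text \<open>\<open>Quat a b c d\<close> is $a + bi + cj + dk$.\<close>

datatype quat = Quat (qRe: real) (qI: real) (qJ: real) (qK: real)

lemma quat_eq_iff: "x = y \<longleftrightarrow> qRe x = qRe y \<and> qI x = qI y \<and> qJ x = qJ y \<and> qK x = qK y"
  by (auto intro: quat.expand)

instantiation quat :: ab_group_add
begin

definition "0 = Quat 0 0 0 0"
definition "x + y = Quat (qRe x + qRe y) (qI x + qI y) (qJ x + qJ y) (qK x + qK y)"
definition "- x = Quat (- qRe x) (- qI x) (- qJ x) (- qK x)"
definition "x - y = Quat (qRe x - qRe y) (qI x - qI y) (qJ x - qJ y) (qK x - qK y)"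

instance
  by standard (simp_all add: zero_quat_def plus_quat_def uminus_quat_def minus_quat_def)

end

lemma quat_add_sel [simp]:
  "qRe 0 = 0" "qI 0 = 0" "qJ 0 = 0" "qK 0 = 0"
  "qRe (x + y) = qRe x + qRe y" "qI (x + y) = qI x + qI y"
  "qJ (x + y) = qJ x + qJ y" "qK (x + y) = qK x + qK y"
  "qRe (- x) = - qRe x" "qI (- x) = - qI x" "qJ (- x) = - qJ x" "qK (- x) = - qK x"
  "qRe (x - y) = qRe x - qRe y" "qI (x - y) = qI x - qI y"
  "qJ (x - y) = qJ x - qJ y" "qK (x - y) = qK x - qK y"
  by (simp_all add: zero_quat_def plus_quat_def uminus_quat_def minus_quat_def)

instantiation quat :: ring_1
begin

definition "1 = Quat 1 0 0 0"
definition "x * y = Quat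
  (qRe x * qRe y - qI x * qI y - qJ x * qJ y - qK x * qK y)
  (qRe x * qI y + qI x * qRe y + qJ x * qK y - qK x * qJ y)
  (qRe x * qJ y - qI x * qK y + qJ x * qRe y + qK x * qI y)
  (qRe x * qK y + qI x * qJ y - qJ x * qI y + qK x * qRe y)"

instance
  by standard (simp_all add: quat_eq_iff one_quat_def times_quat_def algebra_simps)

end

lemma quat_mult_sel [simp]:
  "qRe 1 = 1" "qI 1 = 0" "qJ 1 = 0" "qK 1 = 0"
  "qRe (x * y) = qRe x * qRe y - qI x * qI y - qJ x * qJ y - qK x * qK y"
  "qI (x * y) = qRe x * qI y + qI x * qRe y + qJ x * qK y - qK x * qJ y"
  "qJ (x * y) = qRe x * qJ y - qI x * qK y + qJ x * qRe y + qK x * qI y"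
  "qK (x * y) = qRe x * qK y + qI x * qJ y - qJ x * qI y + qK x * qRe y"
  by (simp_all add: one_quat_def times_quat_def)

instantiation quat :: real_algebra_1
begin

definition "scaleR r x = Quat (r * qRe x) (r * qI x) (r * qJ x) (r * qK x)"

instance
  by standard (simp_all add: quat_eq_iff scaleR_quat_def algebra_simps)

end

lemma quat_scaleR_sel [simp]:
  "qRe (scaleR r x) = r * qRe x" "qI (scaleR r x) = r * qI x"
  "qJ (scaleR r x) = r * qJ x" "qK (scaleR r x) = r * qK x"
  by (simp_all add: scaleR_quat_def)

lemma quat_of_real_sel [simp]:
  "qRe (of_real r) = r" "qI (of_real r) = 0" "qJ (of_real r) = 0" "qK (of_real r) = 0"
  by (simp_all add: of_real_def)

definition qcnj :: "quat \<Rightarrow> quat"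
  where "qcnj x = Quat (qRe x) (- qI x) (- qJ x) (- qK x)"

lemma qcnj_sel [simp]:
  "qRe (qcnj x) = qRe x" "qI (qcnj x) = - qI x" "qJ (qcnj x) = - qJ x" "qK (qcnj x) = - qK x"
  by (simp_all add: qcnj_def)

instantiation quat :: real_normed_div_algebra
begin

definition "norm x = sqrt ((qRe x)\<^sup>2 + (qI x)\<^sup>2 + (qJ x)\<^sup>2 + (qK x)\<^sup>2)"
definition sgn_quat_def: "sgn x = x /\<^sub>R norm x" for x :: quat
definition dist_quat_def: "dist x y = norm (x - y)" for x y :: quat
definition uniformity_quat_def [code del]:
  "(uniformity :: (quat \<times> quat) filter) = (INF e\<in>{0 <..}. principal {(x, y). dist x y < e})"
definition open_quat_def [code del]:
  "open (U :: quat set) \<longleftrightarrow> (\<forall>x\<in>U. eventually (\<lambda>(x', y). x' = x \<longrightarrow> y \<in> U) uniformity)"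
definition inverse_quat_def: "inverse x = qcnj x /\<^sub>R (norm x)\<^sup>2" for x :: quat
definition divide_quat_def: "x div y = x * inverse y" for x y :: quat

instance
proof
  fix r :: real and x y z :: quat
  have pair: "norm u = norm (Complex (qRe u) (qI u), Complex (qJ u) (qK u))" for u :: quat
    by (simp add: norm_quat_def norm_Pair norm_complex_def add.assoc)
  show norm0: "(norm x = 0) = (x = 0)" for x :: quat
    unfolding pair norm_eq_zero by (auto simp: quat_eq_iff complex_eq_iff prod_eq_iff)
  show "norm (x + y) \<le> norm x + norm y"
  proof -
    have "norm (x + y) = norm ((Complex (qRe x) (qI x), Complex (qJ x) (qK x))
      + (Complex (qRe y) (qI y), Complex (qJ y) (qK y)))"
      unfolding pair by (simp add: plus_complex.code)
    then show ?thesis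
      unfolding pair[of x] pair[of y] by (metis norm_triangle_ineq)
  qed
  show "norm (scaleR r x) = \<bar>r\<bar> * norm x"
    by (simp add: norm_quat_def power_mult_distrib distrib_left [symmetric] real_sqrt_mult)
  show "norm (x * y) = norm x * norm y"
    unfolding norm_quat_def real_sqrt_mult [symmetric]
    by (rule arg_cong[of _ _ sqrt]) (simp add: power2_eq_square algebra_simps)
  have sq: "(norm x)\<^sup>2 = (qRe x)\<^sup>2 + (qI x)\<^sup>2 + (qJ x)\<^sup>2 + (qK x)\<^sup>2" for x :: quat
    by (simp add: norm_quat_def)
  have cn: "qcnj x * x = (norm x)\<^sup>2 *\<^sub>R 1" "x * qcnj x = (norm x)\<^sup>2 *\<^sub>R 1"
    unfolding sq by (simp_all add: quat_eq_iff power2_eq_square algebra_simps)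
  show "x \<noteq> 0 \<Longrightarrow> inverse x * x = 1" "x \<noteq> 0 \<Longrightarrow> x * inverse x = 1"
    by (simp_all add: inverse_quat_def cn norm0 scaleR_one)
  show "inverse (0 :: quat) = 0"
    by (simp add: inverse_quat_def quat_eq_iff)
qed (rule sgn_quat_def dist_quat_def open_quat_def uniformity_quat_def divide_quat_def)+

end

definition quat_i :: quat where "quat_i = Quat 0 1 0 0"
definition quat_j :: quat where "quat_j = Quat 0 0 1 0"
definition quat_k :: quat where "quat_k = Quat 0 0 0 1"

lemma quat_units:
  "quat_i * quat_i = -1" "quat_j * quat_j = -1" "quat_k * quat_k = -1"
  "quat_i * quat_j = quat_k" "quat_j * quat_k = quat_i" "quat_k * quat_i = quat_j"
  "quat_j * quat_i = - quat_k" "quat_k * quat_j = - quat_i" "quat_i * quat_k = - quat_j"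
  by (simp_all add: quat_eq_iff quat_i_def quat_j_def quat_k_def)

lemma mult_qcnj: "x * qcnj x = of_real ((norm x)\<^sup>2)" "qcnj x * x = of_real ((norm x)\<^sup>2)"
  by (simp_all add: quat_eq_iff norm_quat_def power2_eq_square algebra_simps)


section \<open>The groups of unit quaternions and of quaternionic unitary matrices\<close>

definition S3 :: "quat monoid"
  where "S3 = \<lparr>carrier = sphere 0 1, mult = (*), one = 1\<rparr>"

lemma S3_sel [simp]:
  "x \<in> carrier S3 \<longleftrightarrow> norm x = 1" "x \<otimes>\<^bsub>S3\<^esub> y = x * y" "\<one>\<^bsub>S3\<^esub> = 1"
  by (simp_all add: S3_def)

lemma group_S3: "group S3"
proof (rule groupI)
  fix x assume "x \<in> carrier S3"
  then show "\<exists>y\<in>carrier S3. y \<otimes>\<^bsub>S3\<^esub> x = \<one>\<^bsub>S3\<^esub>"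
    by (intro bexI[of _ "inverse x"]) (auto simp: norm_inverse intro!: left_inverse)
qed (auto simp: norm_mult mult.assoc)

definition conj_transpose :: "quat ^ 'n ^ 'm \<Rightarrow> quat ^ 'm ^ 'n"
  where "conj_transpose A = (\<chi> i j. qcnj (A $ j $ i))"

definition U2H :: "(quat ^ 2 ^ 2) monoid"
  where "U2H = \<lparr>carrier = {A. A ** conj_transpose A = mat 1}, mult = (**), one = mat 1\<rparr>"

definition conjugate_in :: "('a, 'b) monoid_scheme \<Rightarrow> 'a set \<Rightarrow> 'a set \<Rightarrow> bool"
  where "conjugate_in G A B \<longleftrightarrow> (\<exists>g\<in>carrier G. B = g <#\<^bsub>G\<^esub> A #>\<^bsub>G\<^esub> inv\<^bsub>G\<^esub> g)"


section \<open>The groups \<open>G(K, H, \<phi>)\<close>\<close>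

definition diag2 :: "quat \<Rightarrow> quat \<Rightarrow> quat ^ 2 ^ 2"
  where "diag2 \<xi> \<eta> = vector [vector [\<xi>, 0], vector [0, \<eta>]]"

definition swap2 :: "quat ^ 2 ^ 2"
  where "swap2 = vector [vector [0, 1], vector [1, 0]]"

abbreviation S3_sub :: "quat set \<Rightarrow> quat monoid"
  where "S3_sub K \<equiv> S3\<lparr>carrier := K\<rparr>"

text \<open>Intended for a finite subgroup \<open>K\<close> of \<^const>\<open>S3\<close>, \<open>H \<lhd> S3_sub K\<close> and an involutive
  \<open>\<phi> \<in> auto (S3_sub K Mod H)\<close>; elements of the quotient are the cosets \<open>H\<xi>\<close>.\<close>

definition G_KH :: "quat set \<Rightarrow> quat set \<Rightarrow> (quat set \<Rightarrow> quat set) \<Rightarrow> (quat ^ 2 ^ 2) set"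
  where "G_KH K H \<phi> =
    (let D = {diag2 \<xi> \<eta> | \<xi> \<eta>. \<xi> \<in> K \<and> \<eta> \<in> K \<and> \<phi> (H #>\<^bsub>S3_sub K\<^esub> \<xi>) = H #>\<^bsub>S3_sub K\<^esub> \<eta>}
     in D \<union> (\<lambda>A. A ** swap2) ` D)"

definition zeta :: "nat \<Rightarrow> quat"
  where "zeta q = of_real (cos (2 * pi / real q)) + quat_i * of_real (sin (2 * pi / real q))"

definition C2 :: "quat set"
  where "C2 = {1, -1}"

definition D_grp :: "nat \<Rightarrow> quat set"
  where "D_grp q = generate S3 {zeta (2 * q), quat_j}"

text \<open>Members of \<^const>\<open>auto\<close> are extensional on the carrier, so the two equations on the
  generating cosets determine the automorphism of \<open>D_grp q\<close> modulo \<open>H\<close>, if there is one.\<close>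

definition psi :: "nat \<Rightarrow> quat set \<Rightarrow> nat \<Rightarrow> quat set \<Rightarrow> quat set"
  where "psi q H r =
    (THE \<phi>. \<phi> \<in> auto (S3_sub (D_grp q) Mod H) \<and>
       \<phi> (H #>\<^bsub>S3_sub (D_grp q)\<^esub> zeta (2 * q)) = H #>\<^bsub>S3_sub (D_grp q)\<^esub> (zeta (2 * q) ^ r) \<and>
       \<phi> (H #>\<^bsub>S3_sub (D_grp q)\<^esub> quat_j) = H #>\<^bsub>S3_sub (D_grp q)\<^esub> inverse quat_j)"

end

theory Submission
  imports Defs
begin

text \<open>
  Write \<open>U\<close> for the \<open>2m\<close>-th roots of unity. The group \<open>\<D>\<^sub>m\<close> is \<open>U \<union> Uj\<close>, and since \<open>m\<close> is
  odd, \<open>\<D>\<^sub>2\<^sub>m\<close> is \<open>U \<union> Ui \<union> Uj \<union> Uk\<close>. On it \<open>\<psi>\<^sub>2\<^sub>m\<^sub>-\<^sub>1\<close> is conjugation by \<open>j\<close> times the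
  character that is \<open>1\<close> on \<open>U \<union> Uk\<close> and \<open>-1\<close> on \<open>Ui \<union> Uj\<close>. Conjugating by \<open>diag(1, -j)\<close> thus turns
  the second group into the one generated by the scalars \<open>U\<close> and \<open>k\<close> and by \<open>i Z\<close> and \<open>i X Z\<close>, where
  \<open>Z = diag(1, -1)\<close> and \<open>X\<close> is the coordinate swap. The first group is generated by the
  scalars \<open>U\<close> and \<open>j\<close> and by \<open>Z\<close> and \<open>X\<close>; conjugation by \<open>(1 - i X) / \<surd>2\<close> fixes the scalars \<open>U\<close> and
  \<open>X\<close> and sends \<open>Z\<close> to \<open>-i X Z\<close> and \<open>j\<close> to \<open>-k X\<close>, so it carries one group to the other.
\<close>

section \<open>Automorphisms of quotient groups\<close>

text \<open>Induction on the generation of \<open>x\<close>. This yields uniqueness in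
  \<open>psi\<close>, where an automorphism is prescribed on two cosets only.\<close>

lemma hom_eq_on_generate:
  assumes G: "group G" and Q: "group Q"
    and p: "p \<in> hom G Q" and p': "p' \<in> hom G Q"
    and S: "S \<subseteq> carrier G" and eq: "\<And>s. s \<in> S \<Longrightarrow> p s = p' s"
    and x: "x \<in> generate G S"
  shows "p x = p' x"
proof -
  interpret p: group_hom G Q p
    using G Q p by (simp add: group_hom_def group_hom_axioms_def)
  interpret p': group_hom G Q p'
    using G Q p' by (simp add: group_hom_def group_hom_axioms_def)
  from x show ?thesis
  proof induction
    case one
    then show ?case by (simp only: p.hom_one p'.hom_one)
  next
    case (incl h)
    then show ?case by (rule eq)
  next
    case (inv h)
    then show ?case using S eq by (metis p.hom_inv p'.hom_inv subsetD)
  next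
    case (eng h1 h2)
    then have "h1 \<in> carrier G" "h2 \<in> carrier G"
      using group.generate_in_carrier[OF G S] by blast+
    then show ?case using eng.IH by (simp only: p.hom_mult p'.hom_mult)
  qed
qed

lemma image_r_coset:
  assumes "f \<in> hom G G" "N \<subseteq> carrier G" "f ` N = N" "x \<in> carrier G"
  shows "f ` (N #>\<^bsub>G\<^esub> x) = N #>\<^bsub>G\<^esub> f x"
proof -
  have "f ` (N #>\<^bsub>G\<^esub> x) = (\<Union>h\<in>N. {f (h \<otimes>\<^bsub>G\<^esub> x)})"
    by (auto simp: r_coset_def)
  also have "\<dots> = (\<Union>h\<in>N. {f h \<otimes>\<^bsub>G\<^esub> f x})"
    using assms by (auto simp: hom_mult subset_iff)
  also have "\<dots> = (\<Union>h\<in>f ` N. {h \<otimes>\<^bsub>G\<^esub> f x})"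
    by auto
  finally show ?thesis
    using assms by (simp add: r_coset_def)
qed

text \<open>Since \<open>f\<close> maps \<open>N\<close> onto itself, it permutes the cosets of
  \<open>N\<close>, and direct image is the induced map. The restriction to the carrier is there
  because members of \<open>auto\<close> are extensional.\<close>

lemma image_auto_FactGroup:
  assumes N: "N \<lhd> G" and f: "f \<in> hom G G" and bij: "bij_betw f (carrier G) (carrier G)"
    and fN: "f ` N = N"
  shows "(\<lambda>X\<in>carrier (G Mod N). f ` X) \<in> auto (G Mod N)"
proof -
  interpret normal N G by fact
  have im: "f ` (N #>\<^bsub>G\<^esub> x) = N #>\<^bsub>G\<^esub> f x" if "x \<in> carrier G" for x
    using image_r_coset[OF f subset fN that] .
  have fc: "f x \<in> carrier G" if "x \<in> carrier G" for x
    using bij that by (auto simp: bij_betw_def)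
  have cl: "X \<subseteq> carrier G" if "X \<in> carrier (G Mod N)" for X
    using that subset by (auto simp: carrier_FactGroup dest: r_coset_subset_G[THEN subsetD])
  have Q: "group (G Mod N)"
    by (rule factorgroup_is_group)
  have hom: "(\<lambda>X\<in>carrier (G Mod N). f ` X) \<in> hom (G Mod N) (G Mod N)"
  proof (rule homI)
    fix X assume "X \<in> carrier (G Mod N)"
    then show "(\<lambda>X\<in>carrier (G Mod N). f ` X) X \<in> carrier (G Mod N)"
      using fc by (auto simp: carrier_FactGroup im)
  next
    fix X Y assume X: "X \<in> carrier (G Mod N)" and Y: "Y \<in> carrier (G Mod N)"
    obtain x y where xy: "x \<in> carrier G" "y \<in> carrier G"
      and eqs: "X = N #>\<^bsub>G\<^esub> x" "Y = N #>\<^bsub>G\<^esub> y"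
      using X Y by (auto simp: carrier_FactGroup)
    have "X <#>\<^bsub>G\<^esub> Y \<in> carrier (G Mod N)"
      using X Y group.is_monoid[OF Q] monoid.m_closed by fastforce
    then show "(\<lambda>X\<in>carrier (G Mod N). f ` X) (X \<otimes>\<^bsub>G Mod N\<^esub> Y) =
        (\<lambda>X\<in>carrier (G Mod N). f ` X) X \<otimes>\<^bsub>G Mod N\<^esub> (\<lambda>X\<in>carrier (G Mod N). f ` X) Y"
      using X Y xy fc by (simp add: eqs im rcos_sum hom_mult[OF f])
  qed
  have inj: "inj_on ((`) f) (carrier (G Mod N))"
    using bij cl by (intro inj_onI) (meson bij_betw_def inj_on_image_eq_iff)
  have surj: "((`) f) ` carrier (G Mod N) = carrier (G Mod N)"
  proof -
    have "((`) f) ` carrier (G Mod N) = (\<lambda>x. N #>\<^bsub>G\<^esub> f x) ` carrier G"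
      unfolding carrier_FactGroup image_image using im by (intro image_cong) auto
    also have "\<dots> = (\<lambda>x. N #>\<^bsub>G\<^esub> x) ` (f ` carrier G)"
      by (simp add: image_image)
    finally show ?thesis
      using bij by (simp add: bij_betw_def carrier_FactGroup)
  qed
  show ?thesis
    using hom inj surj by (auto simp: auto_def Bij_def bij_betw_def inj_on_def)
qed

section \<open>Complex numbers inside the quaternions\<close>

text \<open>The copy of the complex field spanned by \<open>1\<close> and \<open>quat_i\<close>.
  With the rule \<open>j w = cnj w j\<close> it reduces products in the dihedral groups to complex
  arithmetic.\<close>

definition qc :: "complex \<Rightarrow> quat"
  where "qc z = Quat (Re z) (Im z) 0 0"

lemma qc_sel [simp]: "qRe (qc z) = Re z" "qI (qc z) = Im z" "qJ (qc z) = 0" "qK (qc z) = 0"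
  by (simp_all add: qc_def)

lemma quat_j_sel [simp]: "qRe quat_j = 0" "qI quat_j = 0" "qJ quat_j = 1" "qK quat_j = 0"
  by (simp_all add: quat_j_def)

lemma qc_mult: "qc (z * w) = qc z * qc w"
  by (simp add: quat_eq_iff)

lemma qc_1 [simp]: "qc 1 = 1"
  by (simp add: quat_eq_iff)

lemma qc_minus [simp]: "qc (- z) = - qc z"
  by (simp add: quat_eq_iff)

lemma qc_power: "qc (z ^ n) = qc z ^ n"
  by (induction n) (simp_all add: qc_mult)

lemma norm_qc [simp]: "norm (qc z) = norm z"
  by (simp add: norm_quat_def norm_complex_def)

lemma norm_quat_j [simp]: "norm quat_j = 1"
  by (simp add: norm_quat_def)

lemma zeta_eq_qc: "zeta q = qc (cis (2 * pi / real q))"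
  by (simp add: zeta_def quat_eq_iff quat_i_def)

lemma inverse_quat_j: "inverse quat_j = - quat_j"
  by (simp add: inverse_quat_def quat_eq_iff)

lemma inv_S3: "norm x = 1 \<Longrightarrow> inv\<^bsub>S3\<^esub> x = inverse x"
  by (rule group.inv_equality[OF group_S3]) (auto simp: norm_inverse intro!: left_inverse)

lemma inverse_unit_quat: "norm x = 1 \<Longrightarrow> inverse x = qcnj x"
  by (simp add: inverse_quat_def)

text \<open>A root of unity has norm 1, so its conjugate is its inverse. For
  \<open>n = 2 * m\<close> this identifies the exponent \<open>2 * m - 1\<close> with
  conjugation.\<close>

lemma cnj_eq_power:
  assumes "z ^ n = 1" "n > 0"
  shows "cnj z = z ^ (n - 1)"
proof -
  have "norm z = 1"
    using assms power_eq_1_iff by blast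
  then have "z * cnj z = 1"
    by (simp add: complex_norm_square[symmetric])
  moreover have "z * z ^ (n - 1) = 1"
    using assms by (metis Suc_diff_1 power_Suc)
  ultimately show ?thesis
    by (metis mult_cancel_left mult_zero_left zero_neq_one)
qed

section \<open>Binary dihedral groups as explicit sets\<close>

text \<open>For even \<open>n > 0\<close> this is the binary dihedral group of order
  \<open>2 * n\<close>. The index is the order of the cyclic part, so \<open>D_grp q\<close> becomes
  \<open>dih (2 * q)\<close>.\<close>

definition dih :: "nat \<Rightarrow> quat set"
  where "dih n = {qc z | z. z ^ n = 1} \<union> {qc z * quat_j | z. z ^ n = 1}"

lemma dihI: "z ^ n = 1 \<Longrightarrow> qc z \<in> dih n" "z ^ n = 1 \<Longrightarrow> qc z * quat_j \<in> dih n"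
  by (auto simp: dih_def)

lemma dihE:
  assumes "x \<in> dih n"
  obtains z where "z ^ n = 1" "x = qc z" | z where "z ^ n = 1" "x = qc z * quat_j"
  using assms by (auto simp: dih_def)

lemma qc_j_mult:
  "qc z * quat_j * qc w = qc (z * cnj w) * quat_j"
  "qc z * (qc w * quat_j) = qc (z * w) * quat_j"
  "qc z * quat_j * (qc w * quat_j) = qc (- (z * cnj w))"
  by (simp_all add: quat_eq_iff algebra_simps)

text \<open>Evenness of \<open>n\<close> makes -1 an \<open>n\<close>-th root of unity, as closure
  requires because \<open>quat_j\<close> squares to -1.\<close>

lemma subgroup_dih:
  assumes "even n" "n > 0"
  shows "subgroup (dih n) S3"
proof
  show "dih n \<subseteq> carrier S3"
    using assms by (auto simp: dih_def norm_mult dest: power_eq_1_iff)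
next
  fix x y assume "x \<in> dih n" "y \<in> dih n"
  then show "x \<otimes>\<^bsub>S3\<^esub> y \<in> dih n"
    using assms(1)
    by (elim dihE) (auto simp: qc_mult[symmetric] qc_j_mult power_mult_distrib
        complex_cnj_power[symmetric] simp del: qc_minus complex_cnj_power intro!: dihI)
next
  show "\<one>\<^bsub>S3\<^esub> \<in> dih n"
    using dihI(1)[of 1] by simp
next
  fix x assume x: "x \<in> dih n"
  then have "norm x = 1"
    using assms by (auto simp: dih_def norm_mult dest: power_eq_1_iff)
  then have inv: "inv\<^bsub>S3\<^esub> x = qcnj x"
    by (simp add: inv_S3 inverse_unit_quat)
  from x show "inv\<^bsub>S3\<^esub> x \<in> dih n"
  proof (cases rule: dihE)
    case (1 z)
    then have "cnj z ^ n = 1"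
      by (metis complex_cnj_one complex_cnj_power)
    moreover have "qcnj x = qc (cnj z)"
      using 1 by (simp add: quat_eq_iff)
    ultimately show ?thesis
      using inv dihI(1) by metis
  next
    case (2 z)
    \<comment> \<open>Products \<open>qc z * quat_j\<close> have no real part, so conjugation
      negates them.\<close>
    then have "qcnj x = qc (- z) * quat_j"
      by (simp add: quat_eq_iff)
    then show ?thesis
      using 2(1) assms dihI(2)[of "- z" n] inv by (metis power_minus_even)
  qed
qed

text \<open>\<open>dih (2 * q)\<close> is a subgroup containing both generators; conversely, every
  root of unity of exponent \<open>2 * q\<close> is a power of \<open>zeta (2 * q)\<close>.\<close>

lemma D_grp_eq:
  assumes "q > 0"
  shows "D_grp q = dih (2 * q)"
proof
  let ?S = "{zeta (2 * q), quat_j}"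
  interpret S3: group S3 by (rule group_S3)
  have "real (2 * q) * (2 * pi / real (2 * q)) = 2 * pi"
    using assms by simp
  then have "cis (2 * pi / real (2 * q)) ^ (2 * q) = 1"
    by (simp only: Complex.DeMoivre cis_2pi)
  then have S: "?S \<subseteq> dih (2 * q)"
    using dihI(1) dihI(2)[of 1] by (auto simp: zeta_eq_qc)
  then show "D_grp q \<subseteq> dih (2 * q)"
    unfolding D_grp_def using subgroup_dih assms by (intro S3.generate_subgroup_incl) auto
  have sub: "subgroup (D_grp q) S3"
    unfolding D_grp_def by (rule S3.generate_is_subgroup) (auto simp: zeta_eq_qc)
  have j: "quat_j \<in> D_grp q" and x: "zeta (2 * q) \<in> D_grp q"
    by (auto simp: D_grp_def intro: generate.incl)
  have m: "a * b \<in> D_grp q" if "a \<in> D_grp q" "b \<in> D_grp q" for a b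
    using subgroup.m_closed[OF sub that] by simp
  have "1 \<in> D_grp q"
    using subgroup.one_closed[OF sub] by simp
  then have pow: "zeta (2 * q) ^ k \<in> D_grp q" for k
    by (induction k) (auto intro: m x)
  have "qc z \<in> D_grp q" if z: "z ^ (2 * q) = 1" for z
  proof -
    obtain k where "z = cis (2 * pi * real k / real (2 * q))"
      using Complex.bij_betw_roots_unity[of "2 * q"] z assms by (auto simp: bij_betw_def simp del: of_nat_mult)
    then have "z = cis (2 * pi / real (2 * q)) ^ k"
      by (simp only: Complex.DeMoivre) (simp add: field_simps)
    then show ?thesis
      using pow[of k] by (simp add: zeta_eq_qc qc_power)
  qed
  then show "dih (2 * q) \<subseteq> D_grp q"
    using j m by (auto elim!: dihE)
qed

section \<open>The automorphisms \<open>\<psi>\<close>\<close>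

lemma r_coset_S3: "H #>\<^bsub>S3\<^esub> x = (\<lambda>h. h * x) ` H"
  by (auto simp: r_coset_def)

text \<open>An automorphism of \<open>D_grp q\<close> that preserves \<open>H\<close> supplies the existence part of the definite
  description in \<open>psi\<close>; uniqueness holds because the two cosets generate the quotient.\<close>

lemma psi_eq:
  assumes N: "H \<lhd> S3_sub (D_grp q)"
    and f: "f \<in> hom (S3_sub (D_grp q)) (S3_sub (D_grp q))"
    and bij: "bij_betw f (D_grp q) (D_grp q)" and fH: "f ` H = H"
    and z: "H #>\<^bsub>S3_sub (D_grp q)\<^esub> f (zeta (2 * q)) = H #>\<^bsub>S3_sub (D_grp q)\<^esub> (zeta (2 * q) ^ r)"
    and j: "H #>\<^bsub>S3_sub (D_grp q)\<^esub> f quat_j = H #>\<^bsub>S3_sub (D_grp q)\<^esub> inverse quat_j"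
    and x: "x \<in> D_grp q"
  shows "psi q H r (H #>\<^bsub>S3_sub (D_grp q)\<^esub> x) = H #>\<^bsub>S3_sub (D_grp q)\<^esub> f x"
proof -
  define D where "D = S3_sub (D_grp q)"
  have carr: "carrier D = D_grp q"
    by (simp add: D_def)
  note assms' = N[folded D_def] f[folded D_def] bij[folded carr] fH z[folded D_def] j[folded D_def]
    x[folded carr]
  interpret H: normal H D by (rule assms'(1))
  interpret S3: group S3 by (rule group_S3)
  let ?S = "{zeta (2 * q), quat_j}"
  have S: "?S \<subseteq> carrier D"
    unfolding carr by (auto simp: D_grp_def intro: generate.incl)
  have gen: "carrier D = generate D ?S"
  proof -
    have sub: "subgroup (D_grp q) S3"
      unfolding D_grp_def by (rule S3.generate_is_subgroup) (auto simp: zeta_eq_qc)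
    show ?thesis
      using S3.generate_consistent[OF _ sub, of ?S] S by (simp add: D_def) (simp add: D_grp_def)
  qed
  have im: "f ` (H #>\<^bsub>D\<^esub> y) = H #>\<^bsub>D\<^esub> f y" if "y \<in> carrier D" for y
    by (rule image_r_coset[OF assms'(2) H.subset assms'(4) that])
  have mem: "H #>\<^bsub>D\<^esub> y \<in> carrier (D Mod H)" if "y \<in> carrier D" for y
    using that by (auto simp: carrier_FactGroup)
  define \<Phi> where "\<Phi> = (\<lambda>X\<in>carrier (D Mod H). f ` X)"
  let ?P = "\<lambda>\<phi>. \<phi> \<in> auto (D Mod H) \<and> \<phi> (H #>\<^bsub>D\<^esub> zeta (2 * q)) = H #>\<^bsub>D\<^esub> (zeta (2 * q) ^ r) \<and>
       \<phi> (H #>\<^bsub>D\<^esub> quat_j) = H #>\<^bsub>D\<^esub> inverse quat_j"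
  have \<Phi>: "?P \<Phi>"
    using image_auto_FactGroup[OF assms'(1-4)] S assms'(5,6) by (auto simp: \<Phi>_def im mem)
  have "psi q H r = \<Phi>"
    unfolding psi_def D_def[symmetric]
  proof (rule the_equality)
    fix \<phi> assume \<phi>: "?P \<phi>"
    show "\<phi> = \<Phi>"
    proof (rule extensionalityI)
      show "\<phi> \<in> extensional (carrier (D Mod H))" "\<Phi> \<in> extensional (carrier (D Mod H))"
        using \<phi> \<Phi> by (auto simp: auto_def Bij_def)
    next
      fix X assume "X \<in> carrier (D Mod H)"
      then obtain y where y: "y \<in> carrier D" "X = H #>\<^bsub>D\<^esub> y"
        by (auto simp: carrier_FactGroup)
      \<comment> \<open>Composing with the projection moves the comparison from the quotient to
        \<open>D\<close>, whose generators are known.\<close>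
      have h: "\<theta> \<circ> (\<lambda>a. H #>\<^bsub>D\<^esub> a) \<in> hom D (D Mod H)" if "?P \<theta>" for \<theta>
        using that H.r_coset_hom_Mod by (auto simp: auto_def intro: hom_compose)
      have "(\<phi> \<circ> (\<lambda>a. H #>\<^bsub>D\<^esub> a)) y = (\<Phi> \<circ> (\<lambda>a. H #>\<^bsub>D\<^esub> a)) y"
      proof (rule hom_eq_on_generate[OF H.is_group H.factorgroup_is_group h[OF \<phi>] h[OF \<Phi>] S])
        show "y \<in> generate D ?S"
          using y(1) gen by simp
      next
        fix s assume "s \<in> ?S"
        then show "(\<phi> \<circ> (\<lambda>a. H #>\<^bsub>D\<^esub> a)) s = (\<Phi> \<circ> (\<lambda>a. H #>\<^bsub>D\<^esub> a)) s"
          using conjunct2[OF \<phi>] conjunct2[OF \<Phi>] by (metis comp_apply empty_iff insert_iff)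
      qed
      then show "\<phi> X = \<Phi> X"
        by (simp add: y)
    qed
  qed (rule \<Phi>)
  then show ?thesis
    using assms'(7) im mem by (simp add: \<Phi>_def D_def[symmetric])
qed

text \<open>For odd \<open>r\<close> the second branch sends \<open>z j\<close> to \<open>(- z) ^ r j = z ^ r j\<^sup>-\<^sup>1\<close>.\<close>

definition dih_aut :: "nat \<Rightarrow> quat \<Rightarrow> quat"
  where "dih_aut r x = (if qJ x = 0 \<and> qK x = 0 then x ^ r else (x * quat_j) ^ r * quat_j)"

lemma dih_aut_qc: "dih_aut r (qc z) = qc (z ^ r)"
  by (simp add: dih_aut_def qc_power)

lemma dih_aut_qc_j:
  assumes "z \<noteq> 0" "odd r"
  shows "dih_aut r (qc z * quat_j) = - (qc (z ^ r) * quat_j)"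
proof -
  have "qc z * quat_j * quat_j = qc (- z)"
    by (simp add: quat_eq_iff)
  then show ?thesis
    using assms by (auto simp: dih_aut_def qc_power complex_eq_iff)
qed

lemma root_unity_neq_0: "z ^ n = 1 \<Longrightarrow> n > 0 \<Longrightarrow> z \<noteq> (0 :: 'a :: semiring_1)"
  by (auto simp: power_0_left)

lemma qc_minus_j: "- (qc z * quat_j) = qc (- z) * quat_j"
  by simp

text \<open>Powers respect products and conjugates of complex numbers. Two elements off the cyclic
  part multiply to \<open>- (z * cnj w)\<close>, and there the signs agree because \<open>r\<close>
  is odd.\<close>

lemma dih_aut_hom:
  assumes "odd r" "even n" "n > 0"
  shows "dih_aut r \<in> hom (S3_sub (dih n)) (S3_sub (dih n))"
proof (rule homI)
  fix x assume "x \<in> carrier (S3_sub (dih n))"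
  then have "x \<in> dih n" by simp
  then show "dih_aut r x \<in> carrier (S3_sub (dih n))"
  proof (cases rule: dihE)
    case (1 z)
    then have "(z ^ r) ^ n = 1"
      by (metis mult.commute power_mult power_one)
    then show ?thesis
      using 1 by (simp add: dih_aut_qc dihI)
  next
    case (2 z)
    then have "(- (z ^ r)) ^ n = 1"
      using assms by (metis mult.commute power_mult power_one power_minus_even)
    then show ?thesis
      using 2 assms root_unity_neq_0[of z n] dihI(2)[of "- (z ^ r)" n]
      by (simp add: dih_aut_qc_j)
  qed
next
  fix x y assume "x \<in> carrier (S3_sub (dih n))" "y \<in> carrier (S3_sub (dih n))"
  then have xy: "x \<in> dih n" "y \<in> dih n" by simp_all
  have nz: "z \<noteq> 0" if "z ^ n = 1" for z :: complex
    using that assms root_unity_neq_0 by blast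
  note eqs = qc_j_mult qc_mult[symmetric] dih_aut_qc dih_aut_qc_j[OF _ assms(1)] qc_minus_j
    power_mult_distrib
  from xy(1) have "dih_aut r (x * y) = dih_aut r x * dih_aut r y"
  proof (cases rule: dihE)
    case x: (1 z)
    from xy(2) show ?thesis
    proof (cases rule: dihE)
      case y: (1 w)
      show ?thesis
        unfolding x y by (simp add: eqs)
    next
      case y: (2 w)
      show ?thesis
        unfolding x y using nz[OF x(1)] nz[OF y(1)] by (simp add: eqs del: qc_minus)
    qed
  next
    case x: (2 z)
    from xy(2) show ?thesis
    proof (cases rule: dihE)
      case y: (1 w)
      show ?thesis
        unfolding x y using nz[OF x(1)] nz[OF y(1)] by (simp add: eqs del: qc_minus)
    next
      case y: (2 w)
      show ?thesis
        unfolding x y using nz[OF x(1)] nz[OF y(1)] assms(1) by (simp add: eqs del: qc_minus)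
    qed
  qed
  then show "dih_aut r (x \<otimes>\<^bsub>S3_sub (dih n)\<^esub> y) =
      dih_aut r x \<otimes>\<^bsub>S3_sub (dih n)\<^esub> dih_aut r y"
    by simp
qed

text \<open>As \<open>r * r\<close> is 1 modulo \<open>n\<close>, raising to the power
  \<open>r\<close> twice fixes each root; on the other coset the two signs cancel. Being its own
  inverse, the map is bijective.\<close>

lemma dih_aut_dih_aut:
  assumes "odd r" "n > 0" "r * r = n * k + 1" "x \<in> dih n"
  shows "dih_aut r (dih_aut r x) = x"
  using assms(4)
proof (cases rule: dihE)
  case (1 z)
  have "(z ^ r) ^ r = z"
    using 1(1) assms(3) by (simp add: power_mult[symmetric] power_add) (simp add: power_mult)
  then show ?thesis
    using 1 by (simp add: dih_aut_qc)
next
  case (2 z)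
  have pow: "(z ^ r) ^ r = z"
    using 2(1) assms(3) by (simp add: power_mult[symmetric] power_add) (simp add: power_mult)
  have nz: "z \<noteq> 0" "- (z ^ r) \<noteq> 0"
    using root_unity_neq_0[OF 2(1)] assms(2) by auto
  show ?thesis
    using 2 nz assms(1) pow by (simp add: dih_aut_qc_j qc_minus_j del: qc_minus)
qed

lemma dih_aut_bij_betw:
  assumes "odd r" "even n" "n > 0" "r * r = n * k + 1"
  shows "bij_betw (dih_aut r) (dih n) (dih n)"
proof (rule bij_betw_byWitness[where f' = "dih_aut r"])
  show "dih_aut r ` dih n \<subseteq> dih n" "dih_aut r ` dih n \<subseteq> dih n"
    using dih_aut_hom[OF assms(1-3)] by (auto simp: hom_def)
qed (use dih_aut_dih_aut[OF assms(1,3,4)] in auto)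

section \<open>Matrices\<close>

definition qmat :: "quat \<Rightarrow> quat \<Rightarrow> quat \<Rightarrow> quat \<Rightarrow> quat ^ 2 ^ 2"
  where "qmat a b c d = vector [vector [a, b], vector [c, d]]"

lemma qmat_eq_iff: "qmat a b c d = qmat a' b' c' d' \<longleftrightarrow> a = a' \<and> b = b' \<and> c = c' \<and> d = d'"
  by (auto simp: qmat_def vec_eq_iff forall_2)

lemma qmat_mult: "qmat a b c d ** qmat a' b' c' d' =
    qmat (a * a' + b * c') (a * b' + b * d') (c * a' + d * c') (c * b' + d * d')"
  by (simp add: qmat_def vec_eq_iff forall_2 matrix_matrix_mult_def sum_2)

lemma mat_1_qmat: "mat 1 = qmat 1 0 0 1"
  by (simp add: qmat_def vec_eq_iff forall_2 mat_def)

lemma conj_transpose_qmat: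
  "conj_transpose (qmat a b c d) = qmat (qcnj a) (qcnj c) (qcnj b) (qcnj d)"
  by (simp add: qmat_def vec_eq_iff forall_2 conj_transpose_def)

lemma diag2_qmat: "diag2 x y = qmat x 0 0 y"
  by (simp add: qmat_def diag2_def)

lemma diag2_swap2_qmat: "diag2 x y ** swap2 = qmat 0 x y 0"
  by (simp add: diag2_def swap2_def qmat_def vec_eq_iff forall_2 matrix_matrix_mult_def sum_2)

text \<open>Writing conjugation as \<open>g ** a = b ** g\<close> keeps the inverse of
  \<open>g\<close> out of the matrix calculations.\<close>

lemma conjugate_in_U2HI:
  assumes g: "g ** conj_transpose g = mat 1" "conj_transpose g ** g = mat 1"
    and unit: "conj_transpose (conj_transpose g) = g"
    and AB: "\<And>a. a \<in> A \<Longrightarrow> \<exists>b\<in>B. g ** a = b ** g"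
    and BA: "\<And>b. b \<in> B \<Longrightarrow> \<exists>a\<in>A. g ** a = b ** g"
  shows "conjugate_in U2H A B"
proof -
  let ?h = "conj_transpose g"
  have inv: "inv\<^bsub>U2H\<^esub> g = ?h"
    unfolding m_inv_def
  proof (rule the_equality)
    fix y assume "y \<in> carrier U2H \<and> g \<otimes>\<^bsub>U2H\<^esub> y = \<one>\<^bsub>U2H\<^esub> \<and> y \<otimes>\<^bsub>U2H\<^esub> g = \<one>\<^bsub>U2H\<^esub>"
    then have "g ** y = mat 1"
      by (simp add: U2H_def)
    then show "y = ?h"
      using g(2) by (metis matrix_mul_assoc matrix_mul_lid matrix_mul_rid)
  \<comment> \<open>By \<open>unit\<close>, the equation
    \<open>conj_transpose g ** g = mat 1\<close> says that \<open>conj_transpose g\<close> itself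
    lies in \<open>U2H\<close>.\<close>
  qed (use g unit in \<open>simp add: U2H_def\<close>)
  have conj: "g ** a ** ?h = b" if "g ** a = b ** g" for a b
    using that g(1) by (metis matrix_mul_assoc matrix_mul_rid)
  have "g <#\<^bsub>U2H\<^esub> A #>\<^bsub>U2H\<^esub> inv\<^bsub>U2H\<^esub> g = (\<lambda>a. g ** a ** ?h) ` A"
    unfolding inv by (auto simp: l_coset_def r_coset_def U2H_def)
  also have "\<dots> = B"
    using AB BA conj by (force simp: image_iff)
  finally show ?thesis
    unfolding conjugate_in_def using g(1) by (intro bexI[of _ g]) (auto simp: U2H_def)
qed

text \<open>This is \<open>diag(1, j) (1 - i X) / \<surd>2\<close>.\<close>

definition conj_mat :: "quat ^ 2 ^ 2"
  where "conj_mat = (let r = 1 / sqrt 2 in qmat (qc (Complex r 0)) (qc (Complex 0 (- r)))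
    (qc (Complex 0 r) * quat_j) (qc (Complex r 0) * quat_j))"

lemma conj_mat_unitary:
  "conj_mat ** conj_transpose conj_mat = mat 1"
  "conj_transpose conj_mat ** conj_mat = mat 1"
  "conj_transpose (conj_transpose conj_mat) = conj_mat"
  by (simp_all add: conj_mat_def Let_def conj_transpose_qmat qmat_mult mat_1_qmat qmat_eq_iff
      quat_eq_iff)

text \<open>One identity for each shape of element in the first group: diagonal or antidiagonal, in
  the cyclic part or its \<open>j\<close>-coset, with equal or opposite entries. The factor
  \<open>diag(1, j)\<close> undoes the conjugation by \<open>diag(1, -j)\<close>.\<close>

lemma conj_mat_intertwines:
  "conj_mat ** qmat (qc z) 0 0 (qc z) = qmat (qc z) 0 0 (qc (cnj z)) ** conj_mat"
  "conj_mat ** qmat (qc z) 0 0 (- qc z) =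
    qmat 0 (- (qc (\<i> * z) * quat_j)) (qc (\<i> * cnj z) * quat_j) 0 ** conj_mat"
  "conj_mat ** qmat 0 (qc z) (qc z) 0 =
    qmat 0 (- (qc z * quat_j)) (qc (cnj z) * quat_j) 0 ** conj_mat"
  "conj_mat ** qmat 0 (qc z) (- qc z) 0 =
    qmat (qc (\<i> * z)) 0 0 (qc (\<i> * cnj z)) ** conj_mat"
  "conj_mat ** qmat (qc z * quat_j) 0 0 (qc z * quat_j) =
    qmat 0 (- qc (\<i> * z)) (- qc (\<i> * cnj z)) 0 ** conj_mat"
  "conj_mat ** qmat (qc z * quat_j) 0 0 (- (qc z * quat_j)) =
    qmat (qc z * quat_j) 0 0 (- (qc (cnj z) * quat_j)) ** conj_mat"
  "conj_mat ** qmat 0 (qc z * quat_j) (qc z * quat_j) 0 =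
    qmat (- (qc (\<i> * z) * quat_j)) 0 0 (qc (\<i> * cnj z) * quat_j) ** conj_mat"
  "conj_mat ** qmat 0 (qc z * quat_j) (- (qc z * quat_j)) 0 =
    qmat 0 (qc z) (qc (cnj z)) 0 ** conj_mat"
  by (simp_all add: conj_mat_def Let_def qmat_mult qmat_eq_iff quat_eq_iff)

section \<open>The two groups\<close>

text \<open>Trades the coset condition for a relation \<open>R\<close> between representatives;
  multiplying by \<open>swap2\<close> makes a diagonal matrix antidiagonal.\<close>

lemma G_KH_eqI:
  assumes "\<And>x y. x \<in> K \<Longrightarrow> y \<in> K \<Longrightarrow>
    \<phi> (H #>\<^bsub>S3_sub K\<^esub> x) = H #>\<^bsub>S3_sub K\<^esub> y \<longleftrightarrow> R x y"
  shows "G_KH K H \<phi> = {qmat x 0 0 y | x y. x \<in> K \<and> y \<in> K \<and> R x y} \<union>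
    {qmat 0 x y 0 | x y. x \<in> K \<and> y \<in> K \<and> R x y}"
proof -
  have "{diag2 x y | x y. x \<in> K \<and> y \<in> K \<and> \<phi> (H #>\<^bsub>S3_sub K\<^esub> x) = H #>\<^bsub>S3_sub K\<^esub> y} =
      {diag2 x y | x y. x \<in> K \<and> y \<in> K \<and> R x y}"
    using assms by blast
  moreover have "(\<lambda>A. A ** swap2) ` {diag2 x y | x y. x \<in> K \<and> y \<in> K \<and> R x y} =
      {qmat 0 x y 0 | x y. x \<in> K \<and> y \<in> K \<and> R x y}"
    by (auto simp: diag2_swap2_qmat[symmetric])
  ultimately show ?thesis
    by (simp add: G_KH_def Let_def diag2_qmat)
qed

lemma group_S3_sub_D_grp: "q > 0 \<Longrightarrow> group (S3_sub (D_grp q))"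
  using subgroup.subgroup_is_group[OF _ group_S3] subgroup_dih by (simp add: D_grp_eq)

lemma minus_dih: "even n \<Longrightarrow> x \<in> dih n \<Longrightarrow> - x \<in> dih n"
  by (erule dihE) (auto simp: qc_minus_j qc_minus[symmetric] simp del: qc_minus intro!: dihI)

text \<open>-1 is central.\<close>

lemma C2_normal:
  assumes "q > 0"
  shows "C2 \<lhd> S3_sub (D_grp q)"
proof -
  interpret D: group "S3_sub (D_grp q)"
    using group_S3_sub_D_grp[OF assms] .
  have one: "1 \<in> D_grp q"
    using D.one_closed by simp
  have "- 1 \<in> D_grp q"
    using minus_dih one assms by (simp add: D_grp_eq)
  then have sub: "subgroup C2 (S3_sub (D_grp q))"
    using one by (intro D.subgroupI) (auto simp: C2_def intro!: D.inv_equality)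
  show ?thesis
    using sub by (intro D.normalI) (auto simp: r_coset_def l_coset_def C2_def)
qed

text \<open>Modulo signs \<open>quat_j\<close> equals its inverse, so the automorphism with
  \<open>r = 1\<close> is the identity, induced by \<open>id\<close>.\<close>

lemma G_D_C2:
  assumes "q > 0"
  shows "G_KH (D_grp q) C2 (psi q C2 1) =
    {qmat x 0 0 y | x y. x \<in> dih (2 * q) \<and> (y = x \<or> y = - x)} \<union>
    {qmat 0 x y 0 | x y. x \<in> dih (2 * q) \<and> (y = x \<or> y = - x)}"
proof -
  have "psi q C2 1 (C2 #>\<^bsub>S3_sub (D_grp q)\<^esub> x) = C2 #>\<^bsub>S3_sub (D_grp q)\<^esub> id x"
    if "x \<in> D_grp q" for x
    by (rule psi_eq[OF C2_normal[OF assms] _ _ _ _ _ that])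
      (auto simp: hom_def r_coset_S3 bij_betw_def C2_def inverse_quat_j
        intro: monoid.m_closed[OF group.is_monoid[OF group_S3_sub_D_grp[OF assms]], simplified])
  then have "psi q C2 1 (C2 #>\<^bsub>S3_sub (D_grp q)\<^esub> x) = C2 #>\<^bsub>S3_sub (D_grp q)\<^esub> y \<longleftrightarrow>
      y = x \<or> y = - x" if "x \<in> D_grp q" for x y
    using that by (auto simp: r_coset_S3 C2_def doubleton_eq_iff)
  from G_KH_eqI[where R = "\<lambda>x y. y = x \<or> y = - x", OF this] show ?thesis
    using minus_dih[of "2 * q"] by (auto simp: D_grp_eq assms) blast+
qed

text \<open>Cosets of the trivial group are singletons, so \<open>psi\<close> is
  \<open>dih_aut\<close> itself and the group consists of its graph and the swapped graph.\<close>

lemma G_D_1: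
  assumes "odd m"
  shows "G_KH (D_grp (2 * m)) {1} (psi (2 * m) {1} (2 * m - 1)) =
    (\<lambda>x. qmat x 0 0 (dih_aut (2 * m - 1) x)) ` dih (4 * m) \<union>
    (\<lambda>x. qmat 0 x (dih_aut (2 * m - 1) x) 0) ` dih (4 * m)"
proof -
  let ?f = "dih_aut (2 * m - 1)"
  have m: "m > 0" "odd (2 * m - 1)"
    using assms by (auto intro: Nat.gr0I)
  have D: "D_grp (2 * m) = dih (4 * m)"
    using m by (simp add: D_grp_eq)
  \<comment> \<open>With \<open>l = m - 1\<close>, the square of \<open>2 * m - 1\<close> is
    \<open>4 * m * l + 1\<close>, hence 1 modulo \<open>4 * m\<close>.\<close>
  obtain l where l: "m = Suc l"
    using m(1) by (cases m) auto
  have r: "(2 * m - 1) * (2 * m - 1) = 4 * m * l + 1"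
    by (simp add: l algebra_simps)
  have hom: "?f \<in> hom (S3_sub (dih (4 * m))) (S3_sub (dih (4 * m)))"
    using m by (intro dih_aut_hom) auto
  have bij: "bij_betw ?f (dih (4 * m)) (dih (4 * m))"
    using m r by (intro dih_aut_bij_betw) auto
  have normal: "{1} \<lhd> S3_sub (D_grp (2 * m))"
    using group.one_is_normal[OF group_S3_sub_D_grp, of "2 * m"] m by simp
  have 1: "?f 1 = 1"
    using dih_aut_qc[of _ 1] by simp
  have j: "?f quat_j = inverse quat_j"
    using dih_aut_qc_j[of 1] m by (simp add: inverse_quat_j)
  have z: "?f (zeta (2 * (2 * m))) = zeta (2 * (2 * m)) ^ (2 * m - 1)"
    by (simp add: zeta_eq_qc dih_aut_qc qc_power)
  have "psi (2 * m) {1} (2 * m - 1) ({1} #>\<^bsub>S3_sub (D_grp (2 * m))\<^esub> x) =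
      {1} #>\<^bsub>S3_sub (D_grp (2 * m))\<^esub> ?f x"
    if "x \<in> D_grp (2 * m)" for x
    by (rule psi_eq[OF normal _ _ _ _ _ that]) (simp_all only: D hom bij 1 j z image_insert image_empty)
  then have "psi (2 * m) {1} (2 * m - 1) ({1} #>\<^bsub>S3_sub (D_grp (2 * m))\<^esub> x) =
      {1} #>\<^bsub>S3_sub (D_grp (2 * m))\<^esub> y \<longleftrightarrow> y = ?f x"
    if "x \<in> D_grp (2 * m)" for x y
    using that by (auto simp: r_coset_S3)
  from G_KH_eqI[where R = "\<lambda>x y. y = ?f x", OF this] show ?thesis
    using bij by (auto simp: D bij_betw_def)
qed

section \<open>The cosets of the \<open>2 * m\<close>-th roots of unity for odd
  \<open>m\<close>\<close>

lemma i_power: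
  assumes "odd m"
  shows "\<i> ^ (2 * m) = - 1" "\<i> ^ (2 * m - 1) = \<i>"
proof -
  show i: "\<i> ^ (2 * m) = - 1"
    using assms by (simp add: power_mult)
  have "2 * m = Suc (2 * m - 1)"
    using assms by (cases m) auto
  then have "\<i> ^ (2 * m) = \<i> ^ (2 * m - 1) * \<i>"
    by (metis power_Suc2)
  then show "\<i> ^ (2 * m - 1) = \<i>"
    using i by (simp add: complex_eq_iff)
qed

text \<open>The \<open>2 * m\<close>-th roots of unity have index 2 among the
  \<open>4 * m\<close>-th ones, and for odd \<open>m\<close> the other coset is represented by
  \<i>.\<close>

lemma dih_4_cases:
  assumes "odd m" "x \<in> dih (4 * m)"
  obtains c where "c ^ (2 * m) = 1" "x = qc c"
  | c where "c ^ (2 * m) = 1" "x = qc (\<i> * c)"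
  | c where "c ^ (2 * m) = 1" "x = qc c * quat_j"
  | c where "c ^ (2 * m) = 1" "x = qc (\<i> * c) * quat_j"
proof -
  have root: "\<exists>c. c ^ (2 * m) = 1 \<and> (z = c \<or> z = \<i> * c)"
    if z: "z ^ (4 * m) = 1" for z :: complex
  proof -
    have "(z ^ (2 * m))\<^sup>2 = 1"
      using z by (simp add: power_mult[symmetric] mult.commute)
    \<comment> \<open>If the power is -1, dividing \<open>z\<close> by \<i> corrects the sign,
      because \<i> also has \<open>2 * m\<close>-th power -1.\<close>
    then have "z ^ (2 * m) = 1 \<or> (- \<i> * z) ^ (2 * m) = 1"
      using i_power(1)[OF assms(1)] by (auto simp: power2_eq_1_iff power_mult_distrib)
    moreover have "z = \<i> * (- \<i> * z)"
      by simp
    ultimately show ?thesis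
      by blast
  qed
  from assms(2) show thesis
  proof (cases rule: dihE)
    case (1 z)
    then show thesis
      using root[of z] that(1,2) by blast
  next
    case (2 z)
    then show thesis
      using root[of z] that(3,4) by blast
  qed
qed

text \<open>The exponent \<open>2 * m - 1\<close> conjugates \<open>c\<close> but fixes \<i>; this
  difference from full conjugation is the character on the cosets.\<close>

lemma dih_aut_values:
  assumes "odd m" "c ^ (2 * m) = 1"
  defines "f \<equiv> dih_aut (2 * m - 1)"
  shows "f (qc c) = qc (cnj c)" "f (qc (\<i> * c)) = qc (\<i> * cnj c)"
    "f (qc c * quat_j) = - (qc (cnj c) * quat_j)"
    "f (qc (\<i> * c) * quat_j) = - (qc (\<i> * cnj c) * quat_j)"
proof -
  have m: "m > 0" "odd (2 * m - 1)"
    using assms by (auto intro: Nat.gr0I)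
  have c: "c \<noteq> 0" "c ^ (2 * m - 1) = cnj c"
    using root_unity_neq_0[OF assms(2)] cnj_eq_power[OF assms(2)] m by simp_all
  have ic: "(\<i> * c) ^ (2 * m - 1) = \<i> * cnj c"
    by (simp only: power_mult_distrib c i_power(2)[OF assms(1)])
  have "\<i> * c \<noteq> 0"
    using c by simp
  then show "f (qc c) = qc (cnj c)" "f (qc (\<i> * c)) = qc (\<i> * cnj c)"
    "f (qc c * quat_j) = - (qc (cnj c) * quat_j)"
    "f (qc (\<i> * c) * quat_j) = - (qc (\<i> * cnj c) * quat_j)"
    unfolding f_def by (simp_all only: dih_aut_qc dih_aut_qc_j[OF _ m(2)] c ic not_False_eq_True)
qed

lemma dih_4_I:
  assumes "odd m" "c ^ (2 * m) = 1"
  shows "qc c \<in> dih (4 * m)" "qc (\<i> * c) \<in> dih (4 * m)"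
    "qc c * quat_j \<in> dih (4 * m)" "qc (\<i> * c) * quat_j \<in> dih (4 * m)"
proof -
  have "c ^ (4 * m) = (c ^ (2 * m))\<^sup>2" "(\<i> * c) ^ (4 * m) = ((\<i> ^ 4) ^ m) * (c ^ (2 * m))\<^sup>2"
    by (simp_all add: power_mult[symmetric] power_mult_distrib mult.commute)
  then have "c ^ (4 * m) = 1" "(\<i> * c) ^ (4 * m) = 1"
    using assms(2) by simp_all
  then show "qc c \<in> dih (4 * m)" "qc (\<i> * c) \<in> dih (4 * m)"
    "qc c * quat_j \<in> dih (4 * m)" "qc (\<i> * c) * quat_j \<in> dih (4 * m)"
    by (simp_all only: dihI)
qed

section \<open>Matching the elements of the two groups\<close>

theorem theorem7p7:
  fixes m :: nat
  assumes "odd m" and "m \<ge> 1"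
  shows "conjugate_in U2H
           (G_KH (D_grp m) C2 (psi m C2 1))
           (G_KH (D_grp (2 * m)) {1} (psi (2 * m) {1} (2 * m - 1)))"
proof -
  let ?f = "dih_aut (2 * m - 1)"
  define A where "A = {qmat x 0 0 y | x y. x \<in> dih (2 * m) \<and> (y = x \<or> y = - x)} \<union>
    {qmat 0 x y 0 | x y. x \<in> dih (2 * m) \<and> (y = x \<or> y = - x)}"
  define B where "B = (\<lambda>x. qmat x 0 0 (?f x)) ` dih (4 * m) \<union> (\<lambda>x. qmat 0 x (?f x) 0) ` dih (4 * m)"
  note vals = dih_aut_values[OF assms(1)]
  have AI: "qmat (qc c) 0 0 (qc c) \<in> A" "qmat (qc c) 0 0 (- qc c) \<in> A"
    "qmat 0 (qc c) (qc c) 0 \<in> A" "qmat 0 (qc c) (- qc c) 0 \<in> A"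
    "qmat (qc c * quat_j) 0 0 (qc c * quat_j) \<in> A"
    "qmat (qc c * quat_j) 0 0 (- (qc c * quat_j)) \<in> A"
    "qmat 0 (qc c * quat_j) (qc c * quat_j) 0 \<in> A"
    "qmat 0 (qc c * quat_j) (- (qc c * quat_j)) 0 \<in> A" if "c ^ (2 * m) = 1" for c
    using dihI[OF that] unfolding A_def by blast+
  have BI: "qmat x 0 0 (?f x) \<in> B" "qmat 0 x (?f x) 0 \<in> B" if "x \<in> dih (4 * m)" for x
    using that by (auto simp: B_def)
  have AB: "\<exists>b\<in>B. conj_mat ** a = b ** conj_mat" if "a \<in> A" for a
  proof -
    define P where "P a \<longleftrightarrow> (\<exists>b\<in>B. conj_mat ** a = b ** conj_mat)" for a
    have PI: "P a" if "b \<in> B" "conj_mat ** a = b ** conj_mat" for a b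
      using that unfolding P_def by blast
    have P: "P (qmat (qc c) 0 0 (qc c))" "P (qmat (qc c) 0 0 (- qc c))"
      "P (qmat 0 (qc c) (qc c) 0)" "P (qmat 0 (qc c) (- qc c) 0)"
      "P (qmat (qc c * quat_j) 0 0 (qc c * quat_j))"
      "P (qmat (qc c * quat_j) 0 0 (- (qc c * quat_j)))"
      "P (qmat 0 (qc c * quat_j) (qc c * quat_j) 0)"
      "P (qmat 0 (qc c * quat_j) (- (qc c * quat_j)) 0)"
      if c: "c ^ (2 * m) = 1" for c
    proof -
      \<comment> \<open>The images of the second, third, fifth and seventh shapes have parameter
        \<open>- c\<close> in place of \<open>c\<close>.\<close>
      have c': "(- c) ^ (2 * m) = 1"
        using c by simp
      note I = dih_4_I[OF assms(1) c] and I' = dih_4_I[OF assms(1) c']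
      note B = BI[OF I(1)] BI[OF I(2)] BI[OF I(3)] BI[OF I'(1)] BI[OF I'(2)] BI[OF I'(3)] BI[OF I'(4)]
      show "P (qmat (qc c) 0 0 (qc c))" "P (qmat (qc c) 0 0 (- qc c))"
        "P (qmat 0 (qc c) (qc c) 0)" "P (qmat 0 (qc c) (- qc c) 0)"
        "P (qmat (qc c * quat_j) 0 0 (qc c * quat_j))"
        "P (qmat (qc c * quat_j) 0 0 (- (qc c * quat_j)))"
        "P (qmat 0 (qc c * quat_j) (qc c * quat_j) 0)"
        "P (qmat 0 (qc c * quat_j) (- (qc c * quat_j)) 0)"
        using B[unfolded vals[OF c] vals[OF c'], simplified]
        by (auto intro: conj_mat_intertwines[THEN PI[rotated]])
    qed
    have "P a"
      \<comment> \<open>The place of the entries, the coset of \<open>x\<close> and the sign of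
        \<open>y\<close> give exactly the eight shapes.\<close>
      using that unfolding A_def by (auto elim!: dihE simp: P)
    then show ?thesis
      unfolding P_def .
  qed
  have BA: "\<exists>a\<in>A. conj_mat ** a = b ** conj_mat" if "b \<in> B" for b
  proof -
    from that obtain x where x: "x \<in> dih (4 * m)"
      and b: "b = qmat x 0 0 (?f x) \<or> b = qmat 0 x (?f x) 0"
      unfolding B_def by blast
    \<comment> \<open>Each coset accounts for two shapes, one with diagonal and one with
      antidiagonal image: 1 and 8, 4 and 5, 6 and 3, 2 and 7. Where the image carries a sign, the
      preimage is taken at \<open>- c\<close>.\<close>
    from assms(1) x show ?thesis
    proof (cases rule: dih_4_cases)
      case (1 c)
      show ?thesis
        using b[unfolded 1(2) vals[OF 1(1)]] AI(1,8)[OF 1(1)] conj_mat_intertwines(1,8)[of c]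
        by metis
    next
      case (2 c)
      then have c': "(- c) ^ (2 * m) = 1"
        by simp
      show ?thesis
        using b[unfolded 2(2) vals[OF 2(1)]] AI(4)[OF 2(1)] conj_mat_intertwines(4)[of c]
          AI(5)[OF c', simplified] conj_mat_intertwines(5)[of "- c", simplified]
        by metis
    next
      case (3 c)
      then have c': "(- c) ^ (2 * m) = 1"
        by simp
      show ?thesis
        using b[unfolded 3(2) vals[OF 3(1)]] AI(6)[OF 3(1)] conj_mat_intertwines(6)[of c]
          AI(3)[OF c', simplified] conj_mat_intertwines(3)[of "- c", simplified]
        by metis
    next
      case (4 c)
      then have c': "(- c) ^ (2 * m) = 1"
        by simp
      show ?thesis
        using b[unfolded 4(2) vals[OF 4(1)]] AI(2,7)[OF c', simplified] conj_mat_intertwines(2,7)[of "- c", simplified]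
        by metis
    qed
  qed
  have "G_KH (D_grp m) C2 (psi m C2 1) = A"
    using G_D_C2 assms unfolding A_def by simp
  moreover have "G_KH (D_grp (2 * m)) {1} (psi (2 * m) {1} (2 * m - 1)) = B"
    using G_D_1[OF assms(1)] unfolding B_def .
  ultimately show ?thesis
    using conjugate_in_U2HI[OF conj_mat_unitary AB BA] by simp
qed

end
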